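(* For all $n,r\in\mathbb N$ with $r\ge 2$ and $n\ge 3^{r+2}$, one can colour the edges of $\mathcal K^{(r)}_{r\times n}$ with two colours so that $V(\mathcal K^{(r)}_{r\times n})$ cannot be partitioned into the vertex sets of fewer than $r+1$ monochromatic tight paths.
   Context: $\mathcal K^{(r)}_{r\times n}$ denotes the complete balanced $r$-partite $r$-uniform hypergraph with $n$ vertices in each of its $r$ partition classes $V_1,\dots,V_r$: its edges are all $r$-element sets of vertices containing exactly one vertex from each $V_i$. A tight path in an $r$-uniform hypergraph is an ordered sequence of distinct vertices such that each $r$ consecutive vertices form an edge (sequences with fewer than $r$ vertices, including the empty one, satisfy this vacuously). A tight path is monochromatic if all its edges (the $r$-sets of consecutive vertices) have the same colour. *)

theory Defs
  imports Main "HOL-Library.Disjoint_Sets"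
begin

(* The vertex (i, j) is the j-th vertex of the i-th partition class;
   classes are numbered 0, ..., r - 1. *)
type_synonym vert = "nat \<times> nat"

definition part_class :: "nat \<Rightarrow> nat \<Rightarrow> vert set" where
  "part_class n i = {i} \<times> {..<n}"

definition K_verts :: "nat \<Rightarrow> nat \<Rightarrow> vert set" where
  "K_verts r n = (\<Union>i<r. part_class n i)"

definition K_edges :: "nat \<Rightarrow> nat \<Rightarrow> vert set set" where
  "K_edges r n =
     {e. e \<subseteq> K_verts r n \<and> card e = r \<and> (\<forall>i<r. card (e \<inter> part_class n i) = 1)}"

(* The sets of r consecutive entries of p; there are none if p has fewer than r entries. *)
definition path_edges :: "nat \<Rightarrow> 'a list \<Rightarrow> 'a set set" where
  "path_edges r p = {set (take r (drop i p)) | i. i + r \<le> length p}"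

definition tight_path :: "nat \<Rightarrow> 'a set \<Rightarrow> 'a set set \<Rightarrow> 'a list \<Rightarrow> bool" where
  "tight_path r V E p \<longleftrightarrow> distinct p \<and> set p \<subseteq> V \<and> path_edges r p \<subseteq> E"

definition monochromatic :: "('a set \<Rightarrow> 'c) \<Rightarrow> nat \<Rightarrow> 'a list \<Rightarrow> bool" where
  "monochromatic col r p \<longleftrightarrow> (\<exists>k. \<forall>e \<in> path_edges r p. col e = k)"

(* Listing the paths counts them with multiplicity, so empty paths may occur, even repeatedly. *)
definition partitioned_by :: "'a set \<Rightarrow> 'a list list \<Rightarrow> bool" where
  "partitioned_by V ps \<longleftrightarrow>
     disjoint_family_on (\<lambda>i. set (ps ! i)) {..<length ps} \<and>
     (\<Union>i<length ps. set (ps ! i)) = V"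

end

theory Submission
  imports Defs
begin

text \<open>
  Let \<open>A\<close> consist of \<open>2 ^ i * r\<^sup>2\<close> vertices of each class \<open>i\<close>, and colour an edge by the parity of
  the number of its vertices in \<open>A\<close>. Consecutive edges of a tight path differ by
  exchanging two vertices of one class, so on a monochromatic tight path vertices at distance \<open>r\<close>
  are in the same class and agree on membership in \<open>A\<close>. Hence a path \<open>p\<close> with an edge meets each
  class in either only \<open>A\<close> or only its complement, and it meets every class in
  \<open>length p div r\<close> vertices, up to a bounded error. The paths that meet \<open>A\<close> in class \<open>i\<close> therefore
  have weights \<open>length p div r\<close> adding up to roughly \<open>2 ^ i * r\<^sup>2\<close>, and all weights add up to roughly
  \<open>n\<close>. These numbers increase so fast that each of the \<open>r + 1\<close> sums involves a path not
  occurring in the previous ones.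
\<close>

section \<open>Numerical estimates\<close>

text \<open>By \<open>upper\<close>, all sets before \<open>S i\<close> together weigh at most the
  sum of the earlier \<open>a j\<close>, and by \<open>lower\<close> and \<open>super\<close> the
  set \<open>S i\<close> weighs more. So each of the \<open>r + 1\<close> sets has an element
  outside all earlier ones.\<close>

lemma superincreasing_sums_card:
  fixes a l :: "_ \<Rightarrow> nat"
  assumes "finite T"
    and sub: "\<And>i. i \<le> r \<Longrightarrow> S i \<subseteq> T"
    and upper: "\<And>i. i < r \<Longrightarrow> sum l (S i) \<le> a i"
    and lower: "\<And>i. i \<le> r \<Longrightarrow> a i \<le> sum l (S i) + c"
    and super: "\<And>i. i \<le> r \<Longrightarrow> (\<Sum>j<i. a j) + c < a i"
  shows "r + 1 \<le> card T"
proof -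
  have fin: "finite (\<Union>i<k. S i)" if "k \<le> r + 1" for k
    using that by (intro finite_UN_I finite_subset[OF sub \<open>finite T\<close>]) auto
  have weight: "sum l (\<Union>i<k. S i) \<le> (\<Sum>j<k. a j)" if "k \<le> r" for k
    using that
  proof (induction k)
    case (Suc k)
    have "sum l (\<Union>i<Suc k. S i) \<le> sum l (\<Union>i<k. S i) + sum l (S k)"
      using sum.union_inter[of "\<Union>i<k. S i" "S k" l] fin[of k] Suc.prems
        finite_subset[OF sub[of k] \<open>finite T\<close>]
      by (simp add: lessThan_Suc Un_commute)
    also have "\<dots> \<le> (\<Sum>j<Suc k. a j)"
      using Suc upper[of k] by simp
    finally show ?case .
  qed simp
  have "k \<le> card (\<Union>i<k. S i)" if "k \<le> r + 1" for k
    using that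
  proof (induction k)
    case (Suc k)
    have "\<not> S k \<subseteq> (\<Union>i<k. S i)"
    proof
      assume "S k \<subseteq> (\<Union>i<k. S i)"
      then have "sum l (S k) \<le> (\<Sum>j<k. a j)"
        using sum_mono2[of "\<Union>i<k. S i" "S k" l] fin[of k] weight[of k] Suc.prems by simp
      then show False
        using lower[of k] super[of k] Suc.prems by simp
    qed
    then have "(\<Union>i<k. S i) \<subset> (\<Union>i<Suc k. S i)"
      by (auto simp: lessThan_Suc)
    then have "card (\<Union>i<k. S i) < card (\<Union>i<Suc k. S i)"
      using fin[of "Suc k"] Suc.prems by (intro psubset_card_mono) auto
    then show ?case
      using Suc by simp
  qed simp
  from this[of "r + 1"] have "r + 1 \<le> card (\<Union>i<r + 1. S i)"
    by simp
  also have "\<dots> \<le> card T"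
    using sub by (intro card_mono \<open>finite T\<close> UN_least) simp
  finally show ?thesis .
qed

text \<open>This is how the assumption on \<open>n\<close> enters: it yields
  \<open>2 ^ r * r\<^sup>2 \<le> n\<close>.\<close>

lemma sq_mult_two_power_le: "2 ^ r * r\<^sup>2 \<le> (3::nat) ^ (r + 2)"
proof (cases "r < 5")
  case True
  then have "r \<in> {0, 1, 2, 3, 4}"
    by auto
  then show ?thesis
    by auto
next
  case False
  then have "5 \<le> r"
    by simp
  then show ?thesis
  proof (induction r rule: nat_induct_at_least)
    case (Suc r)
    \<comment> \<open>The induction step needs \<open>4 * r + 2 \<le> r * r\<close>, which is false
      for \<open>r = 4\<close>; hence the separate check of the values below
      \<open>5\<close>.\<close>
    have "4 * r + 2 \<le> 5 * r"
      using \<open>5 \<le> r\<close> by simp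
    also have "\<dots> \<le> r * r"
      using \<open>5 \<le> r\<close> by simp
    finally have "2 * (Suc r)\<^sup>2 \<le> 3 * r\<^sup>2"
      by (simp add: power2_eq_square)
    then have "2 ^ r * (2 * (Suc r)\<^sup>2) \<le> 2 ^ r * (3 * r\<^sup>2)"
      by (rule mult_left_mono) simp
    also have "\<dots> \<le> 3 ^ (Suc r + 2)"
      using Suc.IH by (simp add: mult.commute)
    finally show ?case
      by simp
  qed simp
qed

section \<open>Structure of monochromatic tight paths\<close>

lemma path_window:
  assumes "path_edges r p \<subseteq> E" and "j + r \<le> length p"
  shows "set (take r (drop j p)) \<in> E"
  using assms by (auto simp: path_edges_def)

lemma set_take_drop:
  assumes "k + m \<le> length p"
  shows "set (take m (drop k p)) = (!) p ` {k..<k + m}"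
proof -
  have "set (take m (drop k p)) = (!) (drop k p) ` {0..<m}"
    using assms by (intro nth_image[symmetric]) simp
  also have "\<dots> = (!) p ` (+) k ` {0..<m}"
    unfolding image_image using assms by (intro image_cong) auto
  finally show ?thesis
    by (simp only: image_add_atLeastLessThan) (simp add: add.commute)
qed

lemma finite_part_class [simp]: "finite (part_class n i)"
  and card_part_class [simp]: "card (part_class n i) = n"
  by (simp_all add: part_class_def card_cartesian_product)

lemma parity_tight_path_periodic:
  assumes p: "tight_path r (K_verts r n) (K_edges r n) p"
    and mono: "monochromatic (\<lambda>e. even (card (e \<inter> A))) r p"
    and j: "j + r < length p" and "0 < r"
  shows "fst (p ! (j + r)) = fst (p ! j)" and "p ! (j + r) \<in> A \<longleftrightarrow> p ! j \<in> A"
proof -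
  \<comment> \<open>\<open>W\<close> holds the \<open>r - 1\<close> vertices shared by the edges
    that start at positions \<open>j\<close> and \<open>j + 1\<close>.\<close>
  define W where "W = (!) p ` {Suc j..<j + r}"
  have dist: "distinct p" and verts: "set p \<subseteq> K_verts r n"
    and edges: "path_edges r p \<subseteq> K_edges r n"
    using p by (auto simp: tight_path_def)
  have ivl: "{j..<j + r} = insert j {Suc j..<j + r}"
    "{Suc j..<Suc j + r} = insert (j + r) {Suc j..<j + r}"
    using \<open>0 < r\<close> by auto
  have e0: "set (take r (drop j p)) = insert (p ! j) W"
    using j set_take_drop[of j r p] ivl(1) by (simp add: W_def)
  have e1: "set (take r (drop (Suc j) p)) = insert (p ! (j + r)) W"
    using j set_take_drop[of "Suc j" r p] ivl(2) by (simp add: W_def)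
  have notin: "p ! j \<notin> W" "p ! (j + r) \<notin> W"
    using dist j by (auto simp: W_def nth_eq_iff_index_eq)
  have E: "insert (p ! j) W \<in> K_edges r n" "insert (p ! (j + r)) W \<in> K_edges r n"
    using path_window[OF edges, of j] path_window[OF edges, of "Suc j"] j e0 e1 by auto
  have "p ! j \<in> K_verts r n" "p ! (j + r) \<in> K_verts r n"
    using verts j by (auto dest: nth_mem)
  then obtain i where i: "i < r" "p ! j \<in> part_class n i"
    by (auto simp: K_verts_def)
  have "card (insert (p ! j) W \<inter> part_class n i) = 1"
    using E(1) i by (auto simp: K_edges_def)
  \<comment> \<open>The first edge already has its only vertex of class \<open>i\<close> in
    \<open>p ! j\<close>, so the second edge can meet this class only in
    \<open>p ! (j + r)\<close>.\<close>
  then have "W \<inter> part_class n i = {}"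
    using i notin by (auto simp: card_1_singleton_iff)
  moreover have "card (insert (p ! (j + r)) W \<inter> part_class n i) = 1"
    using E(2) i by (auto simp: K_edges_def)
  ultimately have "p ! (j + r) \<in> part_class n i"
    by (auto simp: Int_insert_left split: if_splits)
  then show "fst (p ! (j + r)) = fst (p ! j)"
    using i by (auto simp: part_class_def)
  have "set (take r (drop j p)) \<in> path_edges r p" "set (take r (drop (Suc j) p)) \<in> path_edges r p"
    using j by (auto intro!: path_window)
  \<comment> \<open>Both cardinalities exceed \<open>card (W \<inter> A)\<close> by 0 or 1, so equal
    parity forces equal membership in \<open>A\<close>.\<close>
  then have "even (card (insert (p ! j) W \<inter> A)) \<longleftrightarrow> even (card (insert (p ! (j + r)) W \<inter> A))"
    using mono unfolding monochromatic_def e0 e1 by blast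
  moreover have "finite W"
    by (simp add: W_def)
  ultimately show "p ! (j + r) \<in> A \<longleftrightarrow> p ! j \<in> A"
    using notin by (simp add: Int_insert_left split: if_splits)
qed

lemma parity_tight_path_mod:
  assumes p: "tight_path r (K_verts r n) (K_edges r n) p"
    and mono: "monochromatic (\<lambda>e. even (card (e \<inter> A))) r p"
    and "j + k * r < length p" and "0 < r"
  shows "fst (p ! (j + k * r)) = fst (p ! j) \<and> (p ! (j + k * r) \<in> A \<longleftrightarrow> p ! j \<in> A)"
  using assms(3)
proof (induction k)
  case (Suc k)
  then show ?case
    using parity_tight_path_periodic[OF p mono, of "j + k * r"] \<open>0 < r\<close>
    by (simp add: algebra_simps)
qed simp

text \<open>The first edge has exactly one vertex of class \<open>i\<close>, and \<open>j\<close> is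
  its position. Periodicity carries it to all positions congruent to \<open>j\<close> modulo
  \<open>r\<close>; conversely, reducing the position of any vertex of class \<open>i\<close> modulo
  \<open>r\<close> leads back into the first edge, hence to \<open>j\<close>.\<close>

lemma parity_tight_path_class:
  assumes p: "tight_path r (K_verts r n) (K_edges r n) p"
    and mono: "monochromatic (\<lambda>e. even (card (e \<inter> A))) r p"
    and "i < r" and "r \<le> length p"
  obtains j where "j < r"
    and "\<And>k. j + k * r < length p \<Longrightarrow> p ! (j + k * r) \<in> part_class n i"
    and "\<And>k. j + k * r < length p \<Longrightarrow> p ! (j + k * r) \<in> A \<longleftrightarrow> p ! j \<in> A"
    and "set p \<inter> part_class n i \<subseteq> (\<lambda>k. p ! (j + k * r)) ` {k. j + k * r < length p}"
proof -
  have edges: "path_edges r p \<subseteq> K_edges r n" and verts: "set p \<subseteq> K_verts r n"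
    and dist: "distinct p"
    using p by (auto simp: tight_path_def)
  have "0 < r"
    using \<open>i < r\<close> by simp
  have part: "v \<in> part_class n i \<longleftrightarrow> fst v = i" if "v \<in> set p" for v
    using verts that by (force simp: K_verts_def part_class_def)
  have "card (set (take r p) \<inter> part_class n i) = 1"
    using path_window[OF edges, of 0] assms(3,4) by (auto simp: K_edges_def)
  then obtain x where x: "set (take r p) \<inter> part_class n i = {x}"
    by (auto simp: card_1_singleton_iff)
  then have "x \<in> set (take r p)" and xi: "x \<in> part_class n i"
    by auto
  then obtain j where j: "j < r" "p ! j = x"
    by (auto simp: in_set_conv_nth)
  have uniq: "j' = j" if "j' < r" "fst (p ! j') = i" for j'
  proof -
    have "p ! j' \<in> set (take r p)"
      using that assms(4) by (auto simp: in_set_conv_nth intro!: exI[of _ j'])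
    then have "p ! j' = x"
      using x part[of "p ! j'"] that assms(4) by auto
    then show ?thesis
      using j that dist assms(4) by (auto simp: nth_eq_iff_index_eq)
  qed
  have *: "p ! (j + k * r) \<in> part_class n i \<and> (p ! (j + k * r) \<in> A \<longleftrightarrow> p ! j \<in> A)"
    if "j + k * r < length p" for k
    using parity_tight_path_mod[OF p mono that \<open>0 < r\<close>] part[OF nth_mem[OF that]] xi
      j part[of x] assms(4) by auto
  have "set p \<inter> part_class n i \<subseteq> (\<lambda>k. p ! (j + k * r)) ` {k. j + k * r < length p}"
  proof
    fix v assume v: "v \<in> set p \<inter> part_class n i"
    then obtain m where m: "m < length p" "v = p ! m"
      by (auto simp: in_set_conv_nth)
    have "fst (p ! (m mod r)) = i"
      using parity_tight_path_mod[OF p mono, of "m mod r" "m div r"] \<open>0 < r\<close> m v part[of v]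
      by simp
    then have "m mod r = j"
      using uniq \<open>0 < r\<close> by simp
    then have "m = j + m div r * r"
      by (metis mod_mult_div_eq mult.commute)
    with m show "v \<in> (\<lambda>k. p ! (j + k * r)) ` {k. j + k * r < length p}"
      by (intro image_eqI[of _ _ "m div r"]) auto
  qed
  with * j(1) that show ?thesis
    by blast
qed

text \<open>A path with an edge exceeds \<open>length p div r\<close> by at most 1, and
  \<open>1 \<le> r - 1\<close>. A path without edges is unconstrained and may lie inside one class,
  but has at most \<open>r - 1\<close> vertices.\<close>

lemma card_parity_tight_path_upper:
  assumes p: "tight_path r (K_verts r n) (K_edges r n) p"
    and mono: "monochromatic (\<lambda>e. even (card (e \<inter> A))) r p"
    and "i < r" and "2 \<le> r"
  shows "card (set p \<inter> part_class n i) \<le> length p div r + (r - 1)"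
proof (cases "r \<le> length p")
  case True
  then obtain j where
    sub: "set p \<inter> part_class n i \<subseteq> (\<lambda>k. p ! (j + k * r)) ` {k. j + k * r < length p}"
    by (rule parity_tight_path_class[OF p mono \<open>i < r\<close>])
  have "{k. j + k * r < length p} \<subseteq> {..length p div r}"
    using \<open>2 \<le> r\<close> by (auto simp: less_eq_div_iff_mult_less_eq)
  with sub have "set p \<inter> part_class n i \<subseteq> (\<lambda>k. p ! (j + k * r)) ` {..length p div r}"
    by blast
  then have "card (set p \<inter> part_class n i) \<le> card {..length p div r}"
    by (rule surj_card_le[rotated]) simp
  then show ?thesis
    using \<open>2 \<le> r\<close> by simp
next
  case False
  have "card (set p \<inter> part_class n i) \<le> card (set p)"
    by (intro card_mono) auto
  also have "\<dots> \<le> length p"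
    by (rule card_length)
  finally show ?thesis
    using False by simp
qed

text \<open>Each complete block of \<open>r\<close> positions contributes its vertex at offset
  \<open>j\<close>, and one vertex of class \<open>i\<close> in \<open>A\<close> puts all of these
  into \<open>A\<close>. For shorter paths the left side is 0.\<close>

lemma card_parity_tight_path_lower:
  assumes p: "tight_path r (K_verts r n) (K_edges r n) p"
    and mono: "monochromatic (\<lambda>e. even (card (e \<inter> A))) r p"
    and "i < r" and meets: "set p \<inter> part_class n i \<inter> A \<noteq> {}"
  shows "length p div r \<le> card (set p \<inter> part_class n i \<inter> A)"
proof (cases "r \<le> length p")
  case True
  then obtain j where "j < r"
    and cl: "\<And>k. j + k * r < length p \<Longrightarrow> p ! (j + k * r) \<in> part_class n i"
    and A: "\<And>k. j + k * r < length p \<Longrightarrow> p ! (j + k * r) \<in> A \<longleftrightarrow> p ! j \<in> A"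
    and sub: "set p \<inter> part_class n i \<subseteq> (\<lambda>k. p ! (j + k * r)) ` {k. j + k * r < length p}"
    by (rule parity_tight_path_class[OF p mono \<open>i < r\<close>]) (rule that)
  have "p ! j \<in> A"
    using meets sub A by blast
  have bound: "j + k * r < length p" if "k < length p div r" for k
  proof -
    have "j + k * r < Suc k * r"
      using \<open>j < r\<close> by simp
    also have "\<dots> \<le> length p div r * r"
      using that by (intro mult_le_mono1) simp
    also have "\<dots> \<le> length p"
      by simp
    finally show ?thesis .
  qed
  have "inj_on (\<lambda>k. p ! (j + k * r)) {..<length p div r}"
    using p bound \<open>j < r\<close> by (auto simp: inj_on_def tight_path_def nth_eq_iff_index_eq)
  moreover have "(\<lambda>k. p ! (j + k * r)) ` {..<length p div r} \<subseteq> set p \<inter> part_class n i \<inter> A"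
    using bound cl A \<open>p ! j \<in> A\<close> by auto
  ultimately have "card {..<length p div r} \<le> card (set p \<inter> part_class n i \<inter> A)"
    by (intro card_inj_on_le) auto
  then show ?thesis
    by simp
qed simp

section \<open>Counting the paths of a partition\<close>

lemma card_eq_sum_partitioned_by:
  assumes "partitioned_by V ps" and "B \<subseteq> V"
  shows "card B = (\<Sum>t<length ps. card (set (ps ! t) \<inter> B))"
proof -
  have "B = (\<Union>t<length ps. set (ps ! t) \<inter> B)"
    using assms by (auto simp: partitioned_by_def)
  also have "card \<dots> = (\<Sum>t<length ps. card (set (ps ! t) \<inter> B))"
    using assms(1) by (intro card_UN_disjoint) (auto simp: partitioned_by_def disjoint_family_on_def)
  finally show ?thesis .
qed

theorem proposition5:
  fixes n r :: nat
  assumes "r \<ge> 2" and "n \<ge> 3 ^ (r + 2)"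
  shows "\<exists>col :: vert set \<Rightarrow> bool.
           \<not> (\<exists>ps. length ps < r + 1 \<and>
                (\<forall>p \<in> set ps. tight_path r (K_verts r n) (K_edges r n) p \<and> monochromatic col r p) \<and>
                partitioned_by (K_verts r n) ps)"
proof -
  \<comment> \<open>The value \<open>n\<close> at index \<open>r\<close> stands for a whole class.
    The factor \<open>r\<^sup>2\<close> makes the gap between \<open>a i\<close> and the sum of its
    predecessors larger than the total error \<open>r * (r - 1)\<close>.\<close>
  define a where "a i = (if i < r then 2 ^ i * r\<^sup>2 else n)" for i
  define A where "A = (\<Union>i<r. part_class (a i) i)"
  have "2 ^ r * r\<^sup>2 \<le> n"
    using sq_mult_two_power_le[of r] assms(2) by linarith
  have "a i \<le> n" for i
  proof (cases "i < r")
    case True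
    then have "2 ^ i * r\<^sup>2 \<le> 2 ^ r * r\<^sup>2"
      by simp
    also have "\<dots> \<le> n"
      by fact
    finally show ?thesis
      using True by (simp add: a_def)
  qed (simp add: a_def)
  then have A_class: "part_class n i \<inter> A = part_class (a i) i" if "i < r" for i
    using that by (auto simp: A_def part_class_def intro: less_le_trans)
  have a_ge: "2 ^ i * r\<^sup>2 \<le> a i" if "i \<le> r" for i
    using that \<open>2 ^ r * r\<^sup>2 \<le> n\<close> by (auto simp: a_def)
  have super: "(\<Sum>j<i. a j) + r * (r - 1) < a i" if "i \<le> r" for i
  proof -
    have "(\<Sum>j<k. a j) + r\<^sup>2 = 2 ^ k * r\<^sup>2" if "k \<le> r" for k
      using that by (induction k) (auto simp: a_def)
    from this[OF that] a_ge[OF that] have "(\<Sum>j<i. a j) + r\<^sup>2 \<le> a i"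
      by simp
    moreover have "r * (r - 1) < r\<^sup>2"
      using \<open>r \<ge> 2\<close> by (simp add: power2_eq_square)
    ultimately show ?thesis
      by linarith
  qed
  have False
    if len: "length ps < r + 1"
      and paths: "\<And>p. p \<in> set ps \<Longrightarrow> tight_path r (K_verts r n) (K_edges r n) p"
      and mono: "\<And>p. p \<in> set ps \<Longrightarrow> monochromatic (\<lambda>e. even (card (e \<inter> A))) r p"
      and part: "partitioned_by (K_verts r n) ps" for ps
  proof -
    \<comment> \<open>Index \<open>r\<close> gets a full class, whose \<open>n\<close> vertices
      force one path beyond those that meet \<open>A\<close>; class 0 is an arbitrary
      choice.\<close>
    define B where "B i = (if i < r then part_class n i \<inter> A else part_class n 0)" for i
    define l where "l t = length (ps ! t) div r" for t
    define S where "S i = {t. t < length ps \<and> set (ps ! t) \<inter> B i \<noteq> {}}" for i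
    have card_B: "card (B i) = a i" for i
      by (simp add: B_def A_class) (simp add: a_def)
    have B_sum: "a i = (\<Sum>t\<in>S i. card (set (ps ! t) \<inter> B i))" for i
    proof -
      have "part_class n (if i < r then i else 0) \<subseteq> K_verts r n"
        unfolding K_verts_def using \<open>r \<ge> 2\<close> by (intro UN_upper) simp
      then have "B i \<subseteq> K_verts r n"
        by (auto simp: B_def split: if_splits)
      then have "a i = (\<Sum>t<length ps. card (set (ps ! t) \<inter> B i))"
        using card_eq_sum_partitioned_by[OF part] card_B by metis
      also have "\<dots> = (\<Sum>t\<in>S i. card (set (ps ! t) \<inter> B i))"
        by (intro sum.mono_neutral_right) (auto simp: S_def)
      finally show ?thesis .
    qed
    have "sum l (S i) \<le> a i" if "i < r" for i
      unfolding B_sum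
    proof (rule sum_mono)
      fix t assume "t \<in> S i"
      then show "l t \<le> card (set (ps ! t) \<inter> B i)"
        using card_parity_tight_path_lower[OF paths mono \<open>i < r\<close>, of "ps ! t"] \<open>i < r\<close>
        by (simp add: S_def B_def l_def Int_assoc)
    qed
    \<comment> \<open>At most \<open>r\<close> paths are involved, and each costs an error of at
      most \<open>r - 1\<close>.\<close>
    moreover have "a i \<le> sum l (S i) + r * (r - 1)" for i
    proof -
      have "card (set (ps ! t) \<inter> B i) \<le> l t + (r - 1)" if "t \<in> S i" for t
      proof -
        have "card (set (ps ! t) \<inter> B i) \<le> card (set (ps ! t) \<inter> part_class n (if i < r then i else 0))"
          by (intro card_mono) (auto simp: B_def)
        also have "\<dots> \<le> l t + (r - 1)"
          unfolding l_def using that \<open>r \<ge> 2\<close>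
          by (intro card_parity_tight_path_upper[OF paths mono]) (auto simp: S_def)
        finally show ?thesis .
      qed
      then have "a i \<le> (\<Sum>t\<in>S i. l t + (r - 1))"
        unfolding B_sum by (rule sum_mono)
      also have "\<dots> = sum l (S i) + card (S i) * (r - 1)"
        by (simp add: sum.distrib)
      also have "card (S i) \<le> card {..<length ps}"
        by (intro card_mono) (auto simp: S_def)
      then have "card (S i) * (r - 1) \<le> r * (r - 1)"
        using len by (intro mult_le_mono1) simp
      finally show ?thesis
        by simp
    qed
    ultimately have "r + 1 \<le> card {..<length ps}"
      using super by (intro superincreasing_sums_card[where S = S and l = l and a = a]) (auto simp: S_def)
    with len show False
      by simp
  qed
  then show ?thesis
    by blast
qed

end
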